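(* Let $R=\bigoplus_{i\ge0}R_i$ be a (not necessarily Noetherian) positively graded ring with $R_0$ a field and $\mathfrak m_R=\bigoplus_{i>0}R_i$. Let $I\subseteq R$ be a graded ideal. Suppose that there exists a non-zero divisor $f\in I_{\operatorname{indeg}_R(I)}$ such that $Rf\ne I$. Let $M$ be a graded $R$-module (not necessarily finitely generated) such that $\operatorname{indeg}_R(M)<\infty$. Suppose that there exists a graded $R$-module $N$ such that $M\cong I\oplus N$ as graded $R$-modules (up to degree shift), $\operatorname{indeg}_R(I)<\operatorname{indeg}_R(N)$, and $[\operatorname{tr}_R(N)]_{\operatorname{indeg}_R(\mathfrak m_R)}=0$. If $\operatorname{tr}_R(M)$ contains an $R$-regular sequence $\theta_1,\theta_2\in R_{\operatorname{indeg}_R(\mathfrak m_R)}$ and $\dim_{R_0}(M_{\operatorname{indeg}_R(M)})=1$, then $I$ has an $R(-\operatorname{indeg}_R(I))$-free summand.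
   Context: All rings are commutative. For graded $R$-modules $M,N$, ${}^*\mathrm{Hom}_R(M,N)=\bigoplus_{i\in\mathbb Z}[{}^*\mathrm{Hom}_R(M,N)]_i$, where $[{}^*\mathrm{Hom}_R(M,N)]_i=\{\phi\in\mathrm{Hom}_R(M,N):\phi(M_k)\subseteq N_{k+i}\text{ for all }k\in\mathbb Z\}$. The trace ideal of $M$ is $\operatorname{tr}_R(M)=\sum_{\phi\in{}^*\mathrm{Hom}_R(M,R)}\phi(M)$. For a graded $R$-module $M$: $\operatorname{indeg}_R(M)=\infty$ if $M=0$; $\operatorname{indeg}_R(M)=-\infty$ if $M_i\ne0$ for arbitrarily negative integers $i$; and $\operatorname{indeg}_R(M)=\min\{i\in\mathbb Z:M_i\neq0\}$ otherwise. Here $-\infty<i<\infty$ for all $i\in\mathbb Z$. For $i\in\mathbb Z$, a graded $R$-module $M$ is said to have an $R(i)$-free summand if there exists an $R$-epimorphism $\phi\in[{}^*\mathrm{Hom}_R(M,R)]_i$. *)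

theory Defs
  imports
    "HOL-Algebra.Algebra"
    "HOL-Library.Extended"
    "Jordan_Normal_Form.Missing_VectorSpace"
begin

subsection \<open>Graded rings and modules\<close>

definition direct_sum_decomp :: "('b, 'm) ring_scheme \<Rightarrow> (int \<Rightarrow> 'b set) \<Rightarrow> bool" where
  "direct_sum_decomp M Mg \<longleftrightarrow>
     (\<forall>i. additive_subgroup (Mg i) M) \<and>
     (\<forall>x\<in>carrier M. \<exists>!c. (\<forall>i. c i \<in> Mg i) \<and> finite {i. c i \<noteq> \<zero>\<^bsub>M\<^esub>} \<and>
        x = (\<Oplus>\<^bsub>M\<^esub>i\<in>{i. c i \<noteq> \<zero>\<^bsub>M\<^esub>}. c i))"

locale graded_ring = cring R for R (structure) +
  fixes Rg :: "int \<Rightarrow> 'a set"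
  assumes ring_decomp: "direct_sum_decomp R Rg"
    and graded_mult: "\<lbrakk>a \<in> Rg i; b \<in> Rg j\<rbrakk> \<Longrightarrow> a \<otimes> b \<in> Rg (i + j)"

locale positively_graded_ring = graded_ring +
  assumes negative_parts: "i < 0 \<Longrightarrow> Rg i = {\<zero>}"

locale graded_module = graded_ring R Rg + module R M
  for R (structure) and Rg and M (structure) +
  fixes Mg :: "int \<Rightarrow> 'c set"
  assumes module_decomp: "direct_sum_decomp M Mg"
    and graded_smult: "\<lbrakk>a \<in> Rg i; x \<in> Mg j\<rbrakk> \<Longrightarrow> a \<odot>\<^bsub>M\<^esub> x \<in> Mg (i + j)"

text \<open>An ideal \<open>I\<close> of \<open>R\<close> as an \<open>R\<close>-module; the case \<open>I = carrier R\<close> is \<open>R\<close> itself.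
  The fields \<open>mult\<close> and \<open>one\<close> play no role in a module.\<close>

definition ideal_module :: "('a, 'r) ring_scheme \<Rightarrow> 'a set \<Rightarrow> ('a, 'a) module" where
  "ideal_module R I =
     \<lparr>carrier = I, monoid.mult = (\<otimes>\<^bsub>R\<^esub>), one = \<one>\<^bsub>R\<^esub>, ring.zero = \<zero>\<^bsub>R\<^esub>, add = (\<oplus>\<^bsub>R\<^esub>), smult = (\<otimes>\<^bsub>R\<^esub>)\<rparr>"

definition ideal_grading :: "(int \<Rightarrow> 'a set) \<Rightarrow> 'a set \<Rightarrow> int \<Rightarrow> 'a set" where
  "ideal_grading Rg I i = I \<inter> Rg i"

definition graded_ideal :: "('a, 'r) ring_scheme \<Rightarrow> (int \<Rightarrow> 'a set) \<Rightarrow> 'a set \<Rightarrow> bool" where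
  "graded_ideal R Rg I \<longleftrightarrow>
     ideal I R \<and> direct_sum_decomp (ideal_module R I) (ideal_grading Rg I)"

definition irrelevant_ideal :: "('a, 'r) ring_scheme \<Rightarrow> (int \<Rightarrow> 'a set) \<Rightarrow> 'a set" where
  "irrelevant_ideal R Rg =
     {\<Oplus>\<^bsub>R\<^esub>i\<in>J. c i | J c. finite J \<and> J \<subseteq> {0<..} \<and> (\<forall>i\<in>J. c i \<in> Rg i)}"

definition sum_grading :: "(int \<Rightarrow> 'b set) \<Rightarrow> (int \<Rightarrow> 'c set) \<Rightarrow> int \<Rightarrow> ('b \<times> 'c) set" where
  "sum_grading Mg Ng i = Mg i \<times> Ng i"


subsection \<open>Initial degree\<close>

definition indeg :: "('b, 'm) ring_scheme \<Rightarrow> (int \<Rightarrow> 'b set) \<Rightarrow> int extended" where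
  "indeg M Mg =
     (if carrier M = {\<zero>\<^bsub>M\<^esub>} then Pinf
      else if \<forall>n. \<exists>i<n. Mg i \<noteq> {\<zero>\<^bsub>M\<^esub>} then Minf
      else Fin (LEAST i. Mg i \<noteq> {\<zero>\<^bsub>M\<^esub>}))"

text \<open>The component in a possibly infinite degree, such as \<open>indeg M Mg\<close>. The value at
  \<open>\<plusminus>\<infinity>\<close> is a convention.\<close>

definition component :: "('b, 'm) ring_scheme \<Rightarrow> (int \<Rightarrow> 'b set) \<Rightarrow> int extended \<Rightarrow> 'b set" where
  "component M Mg e = (case e of Fin i \<Rightarrow> Mg i | _ \<Rightarrow> {\<zero>\<^bsub>M\<^esub>})"


subsection \<open>Graded homomorphisms and the trace ideal\<close>

definition graded_hom ::
  "('a, 'r) ring_scheme \<Rightarrow> ('a, 'b, 'm) module_scheme \<Rightarrow> (int \<Rightarrow> 'b set) \<Rightarrow>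
   ('a, 'c, 'n) module_scheme \<Rightarrow> (int \<Rightarrow> 'c set) \<Rightarrow> int \<Rightarrow> ('b \<Rightarrow> 'c) set" where
  "graded_hom R M Mg N Ng i =
     {\<phi> \<in> module_hom R M N. \<forall>k. \<phi> ` Mg k \<subseteq> Ng (k + i)}"

definition star_hom ::
  "('a, 'r) ring_scheme \<Rightarrow> ('a, 'b, 'm) module_scheme \<Rightarrow> (int \<Rightarrow> 'b set) \<Rightarrow>
   ('a, 'c, 'n) module_scheme \<Rightarrow> (int \<Rightarrow> 'c set) \<Rightarrow> ('b \<Rightarrow> 'c) set" where
  "star_hom R M Mg N Ng =
     {\<phi> \<in> module_hom R M N. \<exists>J \<psi>. finite J \<and> (\<forall>i\<in>J. \<psi> i \<in> graded_hom R M Mg N Ng i) \<and>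
        (\<forall>x\<in>carrier M. \<phi> x = (\<Oplus>\<^bsub>N\<^esub>i\<in>J. \<psi> i x))}"

definition trace_ideal ::
  "('a, 'r) ring_scheme \<Rightarrow> (int \<Rightarrow> 'a set) \<Rightarrow> ('a, 'b, 'm) module_scheme \<Rightarrow>
   (int \<Rightarrow> 'b set) \<Rightarrow> 'a set" where
  "trace_ideal R Rg M Mg =
     {\<Oplus>\<^bsub>R\<^esub>\<phi>\<in>F. \<phi> (x \<phi>) | F x. finite F \<and>
        F \<subseteq> star_hom R M Mg (ideal_module R (carrier R)) Rg \<and> (\<forall>\<phi>\<in>F. x \<phi> \<in> carrier M)}"

definition has_free_summand ::
  "('a, 'r) ring_scheme \<Rightarrow> (int \<Rightarrow> 'a set) \<Rightarrow> ('a, 'b, 'm) module_scheme \<Rightarrow>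
   (int \<Rightarrow> 'b set) \<Rightarrow> int \<Rightarrow> bool" where
  "has_free_summand R Rg M Mg i \<longleftrightarrow>
     (\<exists>\<phi>\<in>graded_hom R M Mg (ideal_module R (carrier R)) Rg i. \<phi> ` carrier M = carrier R)"

text \<open>An isomorphism of \<open>M\<close> with the shifted module \<open>N(s)\<close>, where \<open>N(s)\<^sub>k = N\<^sub>k\<^sub>+\<^sub>s\<close>,
  for some \<open>s\<close>.\<close>

definition graded_iso_upto_shift ::
  "('a, 'r) ring_scheme \<Rightarrow> ('a, 'b, 'm) module_scheme \<Rightarrow> (int \<Rightarrow> 'b set) \<Rightarrow>
   ('a, 'c, 'n) module_scheme \<Rightarrow> (int \<Rightarrow> 'c set) \<Rightarrow> bool" where
  "graded_iso_upto_shift R M Mg N Ng \<longleftrightarrow>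
     (\<exists>s. \<exists>\<phi>\<in>graded_hom R M Mg N Ng s. bij_betw \<phi> (carrier M) (carrier N))"


subsection \<open>Regular sequences\<close>

definition nonzerodivisor :: "('a, 'r) ring_scheme \<Rightarrow> 'a \<Rightarrow> bool" where
  "nonzerodivisor R x \<longleftrightarrow>
     x \<in> carrier R \<and> (\<forall>y\<in>carrier R. x \<otimes>\<^bsub>R\<^esub> y = \<zero>\<^bsub>R\<^esub> \<longrightarrow> y = \<zero>\<^bsub>R\<^esub>)"

definition regular_sequence :: "('a, 'r) ring_scheme \<Rightarrow> 'a list \<Rightarrow> bool" where
  "regular_sequence R xs \<longleftrightarrow>
     set xs \<subseteq> carrier R \<and>
     (\<forall>i<length xs. let J = Idl\<^bsub>R\<^esub> (set (take i xs)) in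
        nonzerodivisor (R Quot J) (J +>\<^bsub>R\<^esub> xs ! i)) \<and>
     Idl\<^bsub>R\<^esub> (set xs) \<noteq> carrier R"

end

theory Submission
  imports Defs
begin

text \<open>Let \<open>d\<close> be the initial degree of \<open>I\<close> and \<open>e\<close> that of the irrelevant ideal. As \<open>f\<close> is a
  non-zero divisor, a homomorphism \<open>\<psi> : I \<rightarrow> R\<close> is multiplication by \<open>\<psi>(f)/f\<close>. If \<open>\<psi>\<close> has degree
  \<open>-d\<close> and \<open>\<psi>(f) \<noteq> 0\<close>, then \<open>\<psi>(f)\<close> is a unit and \<open>\<psi>\<close> is the required epimorphism. Otherwise every
  nonzero homogeneous \<open>\<psi>\<close> sends \<open>f\<close> into degree at least \<open>e\<close>, so only elements of \<open>I\<close> of degree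
  at most \<open>d\<close>, that is multiples of \<open>f\<close>, contribute to the trace of \<open>I\<close> in degree \<open>e\<close>. The trace of
  \<open>N\<close> vanishes in that degree, hence \<open>\<theta>\<^sub>1\<close> and \<open>\<theta>\<^sub>2\<close> are values at \<open>f\<close> of homomorphisms \<open>I \<rightarrow> R\<close>,
  and regularity of \<open>\<theta>\<^sub>1, \<theta>\<^sub>2\<close> gives \<open>I = Rf\<close>, a contradiction.\<close>

subsection \<open>Homogeneous parts\<close>

lemma (in abelian_monoid) finsum_induct:
  assumes "finite J" "\<And>i. i \<in> J \<Longrightarrow> c i \<in> carrier G"
    and "P \<zero>" "\<And>x y. x \<in> carrier G \<Longrightarrow> y \<in> carrier G \<Longrightarrow> P x \<Longrightarrow> P y \<Longrightarrow> P (x \<oplus> y)"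
    and "\<And>i. i \<in> J \<Longrightarrow> P (c i)"
  shows "P (\<Oplus>i\<in>J. c i)"
  using assms(1,2,5)
proof (induction J)
  case (insert j J)
  have "(\<Oplus>i\<in>J. c i) \<in> carrier G"
    using insert by (intro finsum_closed) auto
  then show ?case
    using insert assms(4) by (subst finsum_insert) auto
qed (use assms(3) in simp)

text \<open>Only the additive group and its grading enter the calculus of homogeneous parts, so one
  locale serves the ring, its modules and its graded ideals.\<close>

locale graded_group = abelian_group M for M (structure) +
  fixes Mg :: "int \<Rightarrow> 'a set"
  assumes decomp: "direct_sum_decomp M Mg"
begin

lemma component_subgroup: "additive_subgroup (Mg i) M"
  using decomp by (simp add: direct_sum_decomp_def)

lemma component_carrier [intro]: "x \<in> Mg i \<Longrightarrow> x \<in> carrier M"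
  using additive_subgroup.a_Hcarr[OF component_subgroup] .

lemma zero_component [simp, intro]: "\<zero> \<in> Mg i"
  using additive_subgroup.zero_closed[OF component_subgroup] .

lemma add_component [intro]: "x \<in> Mg i \<Longrightarrow> y \<in> Mg i \<Longrightarrow> x \<oplus> y \<in> Mg i"
  using additive_subgroup.a_closed[OF component_subgroup] .

lemma a_inv_component [intro]: "x \<in> Mg i \<Longrightarrow> \<ominus> x \<in> Mg i"
  using subgroup.m_inv_closed[OF additive_subgroup.a_subgroup[OF component_subgroup]]
  by (simp add: a_inv_def)

text \<open>The family of homogeneous components of \<open>x\<close>; on the carrier the description
  is well defined by the uniqueness built into \<open>direct_sum_decomp\<close>.\<close>

definition parts :: "'a \<Rightarrow> int \<Rightarrow> 'a" where
  "parts x = (THE c. (\<forall>i. c i \<in> Mg i) \<and> finite {i. c i \<noteq> \<zero>} \<and>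
     x = (\<Oplus>i\<in>{i. c i \<noteq> \<zero>}. c i))"

lemma decomp_ex1:
  assumes "x \<in> carrier M"
  shows "\<exists>!c. (\<forall>i. c i \<in> Mg i) \<and> finite {i. c i \<noteq> \<zero>} \<and> x = (\<Oplus>i\<in>{i. c i \<noteq> \<zero>}. c i)"
  using decomp assms unfolding direct_sum_decomp_def by blast

lemma
  assumes "x \<in> carrier M"
  shows parts_component [simp, intro]: "parts x i \<in> Mg i"
    and finite_parts: "finite {i. parts x i \<noteq> \<zero>}"
    and sum_parts: "x = (\<Oplus>i\<in>{i. parts x i \<noteq> \<zero>}. parts x i)"
  using theI'[OF decomp_ex1[OF assms]] unfolding parts_def by blast+

lemma parts_closed [simp, intro]: "x \<in> carrier M \<Longrightarrow> parts x i \<in> carrier M"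
  by blast

lemma sum_parts_superset:
  assumes "x \<in> carrier M" "finite J" "{i. parts x i \<noteq> \<zero>} \<subseteq> J"
  shows "(\<Oplus>i\<in>J. parts x i) = x"
proof -
  have "(\<Oplus>i\<in>{i. parts x i \<noteq> \<zero>}. parts x i) = (\<Oplus>i\<in>J. parts x i)"
    by (rule add.finprod_mono_neutral_cong_left) (use assms in auto)
  then show ?thesis
    using sum_parts[OF assms(1)] by simp
qed

text \<open>Extended by zero outside \<open>J\<close>, the family \<open>c\<close> satisfies the
  conditions that determine \<open>parts\<close> uniquely. Its support may be smaller than
  \<open>J\<close>, which does not change the sum.\<close>

lemma parts_sum:
  assumes J: "finite J" and c: "\<And>i. i \<in> J \<Longrightarrow> c i \<in> Mg i"
  shows "parts (\<Oplus>i\<in>J. c i) k = (if k \<in> J then c k else \<zero>)"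
proof -
  let ?c = "\<lambda>i. if i \<in> J then c i else \<zero>"
  have x: "(\<Oplus>i\<in>J. c i) \<in> carrier M"
    using c by (intro finsum_closed) auto
  have "(\<Oplus>i\<in>{i. ?c i \<noteq> \<zero>}. ?c i) = (\<Oplus>i\<in>J. c i)"
    by (rule add.finprod_mono_neutral_cong_left) (use J c in auto)
  then have "parts (\<Oplus>i\<in>J. c i) = ?c"
    unfolding parts_def
    using J c by (intro the1_equality[OF decomp_ex1[OF x]]) auto
  then show ?thesis by simp
qed

lemma parts_homogeneous:
  assumes "x \<in> Mg k"
  shows "parts x i = (if i = k then x else \<zero>)"
proof -
  have "(\<Oplus>j\<in>{k}. x) = x"
    using component_carrier[OF assms] by simp
  then show ?thesis
    using parts_sum[of "{k}" "\<lambda>_. x" i] assms by simp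
qed

lemma parts_add:
  assumes x: "x \<in> carrier M" and y: "y \<in> carrier M"
  shows "parts (x \<oplus> y) k = parts x k \<oplus> parts y k"
proof -
  \<comment> \<open>Both supports lie in \<open>?J\<close>, and \<open>k\<close> is inserted so that
    \<open>parts_sum\<close> returns the term at \<open>k\<close> even when both parts vanish
    there.\<close>
  let ?J = "insert k ({i. parts x i \<noteq> \<zero>} \<union> {i. parts y i \<noteq> \<zero>})"
  have J: "finite ?J" using finite_parts x y by simp
  have "x \<oplus> y = (\<Oplus>i\<in>?J. parts x i) \<oplus> (\<Oplus>i\<in>?J. parts y i)"
    by (subst (1 2) sum_parts_superset) (use x y J in auto)
  also have "\<dots> = (\<Oplus>i\<in>?J. parts x i \<oplus> parts y i)"
    by (rule finsum_addf[symmetric]) (use x y in auto)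
  finally show ?thesis
    using parts_sum[OF J, of "\<lambda>i. parts x i \<oplus> parts y i" k] x y by auto
qed

lemma homogeneous_induct [consumes 1, case_names zero add homogeneous]:
  assumes x: "x \<in> carrier M" and "P \<zero>"
    and "\<And>x y. x \<in> carrier M \<Longrightarrow> y \<in> carrier M \<Longrightarrow> P x \<Longrightarrow> P y \<Longrightarrow> P (x \<oplus> y)"
    and "\<And>x k. x \<in> Mg k \<Longrightarrow> P x"
  shows "P x"
proof -
  have "P (\<Oplus>i\<in>{i. parts x i \<noteq> \<zero>}. parts x i)"
    by (rule finsum_induct) (use assms(2,3) assms(4)[OF parts_component] finite_parts[OF x] x in auto)
  then show ?thesis using sum_parts[OF x] by simp
qed

end

lemma (in graded_module) graded_group_module: "graded_group M Mg"
  by unfold_locales (rule module_decomp)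

lemma (in graded_ring) graded_group_ring: "graded_group R Rg"
  by unfold_locales (rule ring_decomp)


subsection \<open>Ideals as graded modules\<close>

lemma ideal_module_simps [simp]:
  "carrier (ideal_module R I) = I" "\<zero>\<^bsub>ideal_module R I\<^esub> = \<zero>\<^bsub>R\<^esub>"
  "x \<oplus>\<^bsub>ideal_module R I\<^esub> y = x \<oplus>\<^bsub>R\<^esub> y" "a \<odot>\<^bsub>ideal_module R I\<^esub> x = a \<otimes>\<^bsub>R\<^esub> x"
  by (simp_all add: ideal_module_def)

lemma (in cring) module_ideal_module:
  assumes "ideal I R"
  shows "module R (ideal_module R I)"
proof -
  interpret I: ideal I R by fact
  have "abelian_group (ideal_module R I)"
  proof (rule abelian_groupI)
    fix x assume "x \<in> carrier (ideal_module R I)"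
    then show "\<exists>y\<in>carrier (ideal_module R I). y \<oplus>\<^bsub>ideal_module R I\<^esub> x = \<zero>\<^bsub>ideal_module R I\<^esub>"
      by (intro bexI[of _ "\<ominus> x"]) (auto simp: l_neg)
  qed (use I.Icarr I.a_closed a_assoc a_comm in auto)
  then show ?thesis
    by (intro moduleI)
      (use I.Icarr I.I_l_closed cring_axioms in \<open>auto simp: l_distr r_distr m_assoc\<close>)
qed

text \<open>Both structures have the same carrier, zero and addition, so sums of values in the
  target of \<open>star_hom\<close> can be computed in \<open>R\<close>.\<close>

lemma finsum_ideal_module_carrier:
  "finsum (ideal_module R (carrier R)) = finsum R"
  by (intro ext) (simp add: finsum_def finprod_def ideal_module_def)

lemma (in graded_ring) graded_module_ideal:
  assumes "graded_ideal R Rg I"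
  shows "graded_module R Rg (ideal_module R I) (ideal_grading Rg I)"
proof -
  have I: "ideal I R" and D: "direct_sum_decomp (ideal_module R I) (ideal_grading Rg I)"
    using assms by (auto simp: graded_ideal_def)
  show ?thesis
    by (intro graded_module.intro graded_module_axioms.intro module_ideal_module I D graded_ring_axioms)
      (use ideal.I_l_closed[OF I] graded_mult graded_group.component_carrier[OF graded_group_ring] in
        \<open>auto simp: ideal_grading_def\<close>)
qed


subsection \<open>Initial degree\<close>

text \<open>The integers are not well-ordered, so \<open>LEAST\<close> means something only because
  some \<open>n\<close> bounds the non-zero degrees from below. The non-zero degrees up to
  \<open>i\<close> then form a finite set, whose minimum is the \<open>LEAST\<close>.\<close>

lemma indeg_below:
  assumes "indeg M Mg = Fin d" "i < d"
  shows "Mg i = {\<zero>\<^bsub>M\<^esub>}"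
proof (rule ccontr)
  assume i: "Mg i \<noteq> {\<zero>\<^bsub>M\<^esub>}"
  have b: "\<not> (\<forall>n. \<exists>i<n. Mg i \<noteq> {\<zero>\<^bsub>M\<^esub>})" and d: "d = (LEAST i. Mg i \<noteq> {\<zero>\<^bsub>M\<^esub>})"
    using assms(1) unfolding indeg_def by (simp_all split: if_splits)
  from b obtain n where n: "\<not> (\<exists>i<n. Mg i \<noteq> {\<zero>\<^bsub>M\<^esub>})"
    by blast
  define S where "S = {j. Mg j \<noteq> {\<zero>\<^bsub>M\<^esub>} \<and> j \<le> i}"
  have "S \<subseteq> {n..i}"
  proof
    fix j assume "j \<in> S"
    then have "\<not> j < n" "j \<le> i" using n unfolding S_def by blast+
    then show "j \<in> {n..i}" by simp
  qed
  then have S: "finite S" "S \<noteq> {}" using i finite_subset by (auto simp: S_def)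
  have "(LEAST i. Mg i \<noteq> {\<zero>\<^bsub>M\<^esub>}) = Min S"
  proof (rule Least_equality)
    show "Mg (Min S) \<noteq> {\<zero>\<^bsub>M\<^esub>}" using Min_in[OF S] by (simp add: S_def)
    fix j assume "Mg j \<noteq> {\<zero>\<^bsub>M\<^esub>}"
    then show "Min S \<le> j"
      using Min_le[OF S(1), of j] Min_in[OF S] by (cases "j \<le> i") (auto simp: S_def)
  qed
  moreover have "Min S \<le> i" using Min_in[OF S] by (simp add: S_def)
  ultimately show False using d assms(2) by simp
qed

lemma (in graded_group) indeg_eqI:
  assumes "Mg d \<noteq> {\<zero>}" "\<And>i. i < d \<Longrightarrow> Mg i = {\<zero>}"
  shows "indeg M Mg = Fin d"
proof -
  have "carrier M \<noteq> {\<zero>}" using assms(1) component_carrier[of _ d] zero_component[of d] by auto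
  moreover have "(LEAST i. Mg i \<noteq> {\<zero>}) = d"
    by (rule Least_equality) (use assms in \<open>auto simp: not_less[symmetric]\<close>)
  ultimately show ?thesis using assms(2) by (auto simp: indeg_def)
qed

text \<open>The strict inequality also allows the value \<open>Pinf\<close>, that is the zero
  module, and rules out \<open>Minf\<close>.\<close>

lemma (in graded_group) indeg_greater:
  assumes "Fin d < indeg M Mg" "i \<le> d"
  shows "Mg i = {\<zero>}"
proof (cases "indeg M Mg")
  case (Fin e)
  then show ?thesis using indeg_below[OF Fin] assms by simp
next
  case Pinf
  then have "carrier M = {\<zero>}" by (simp add: indeg_def split: if_splits)
  then show ?thesis using component_carrier[of _ i] zero_component[of i] by auto
qed (use assms in simp)


subsection \<open>Graded homomorphisms and traces\<close>

lemma graded_homD: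
  assumes "\<phi> \<in> graded_hom R M Mg N Ng i"
  shows "\<phi> \<in> module_hom R M N" "x \<in> carrier M \<Longrightarrow> \<phi> x \<in> carrier N" "x \<in> Mg k \<Longrightarrow> \<phi> x \<in> Ng (k + i)"
  using assms unfolding graded_hom_def module_hom_def by blast+

lemma graded_homI:
  assumes "\<And>x. x \<in> carrier M \<Longrightarrow> \<phi> x \<in> carrier N"
    and "\<And>x y. x \<in> carrier M \<Longrightarrow> y \<in> carrier M \<Longrightarrow> \<phi> (x \<oplus>\<^bsub>M\<^esub> y) = \<phi> x \<oplus>\<^bsub>N\<^esub> \<phi> y"
    and "\<And>r x. r \<in> carrier R \<Longrightarrow> x \<in> carrier M \<Longrightarrow> \<phi> (r \<odot>\<^bsub>M\<^esub> x) = r \<odot>\<^bsub>N\<^esub> \<phi> x"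
    and "\<And>x k. x \<in> Mg k \<Longrightarrow> \<phi> x \<in> Ng (k + i)"
  shows "\<phi> \<in> graded_hom R M Mg N Ng i"
  using assms unfolding graded_hom_def module_hom_def by blast

lemma graded_hom_comp:
  assumes "\<phi> \<in> graded_hom R A Ag B Bg i" "\<psi> \<in> graded_hom R B Bg C Cg j"
  shows "\<psi> \<circ> \<phi> \<in> graded_hom R A Ag C Cg (i + j)"
proof (rule graded_homI)
  show "(\<psi> \<circ> \<phi>) x \<in> Cg (k + (i + j))" if "x \<in> Ag k" for x k
    using graded_homD(3)[OF assms(2) graded_homD(3)[OF assms(1) that]] by (simp add: add.assoc)
qed (use graded_homD(1,2)[OF assms(1)] graded_homD(1,2)[OF assms(2)] in
    \<open>simp_all add: module_hom_add module_hom_smult\<close>)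

lemma module_hom_zero:
  assumes "abelian_group M" "abelian_group N" "\<phi> \<in> module_hom R M N"
  shows "\<phi> \<zero>\<^bsub>M\<^esub> = \<zero>\<^bsub>N\<^esub>"
proof -
  interpret M: abelian_group M by fact
  interpret N: abelian_group N by fact
  have "\<phi> \<zero>\<^bsub>M\<^esub> \<oplus>\<^bsub>N\<^esub> \<phi> \<zero>\<^bsub>M\<^esub> = \<phi> \<zero>\<^bsub>M\<^esub>"
    using module_hom_add[OF assms(3), of "\<zero>\<^bsub>M\<^esub>" "\<zero>\<^bsub>M\<^esub>"] by simp
  moreover have "\<phi> \<zero>\<^bsub>M\<^esub> \<in> carrier N"
    using module_hom_closed[OF assms(3)] by auto
  ultimately show ?thesis
    using N.add.l_cancel_one[of "\<phi> \<zero>\<^bsub>M\<^esub>" "\<phi> \<zero>\<^bsub>M\<^esub>"] by simp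
qed

text \<open>Both sides are additive in \<open>x\<close>, and for \<open>x\<close> homogeneous of
  degree \<open>j\<close> both vanish unless \<open>j = k\<close>.\<close>

lemma graded_hom_parts:
  assumes "graded_group M Mg" "graded_group N Ng"
    and \<phi>: "\<phi> \<in> graded_hom R M Mg N Ng s" and x: "x \<in> carrier M"
  shows "graded_group.parts N Ng (\<phi> x) (k + s) = \<phi> (graded_group.parts M Mg x k)"
proof -
  interpret M: graded_group M Mg by fact
  interpret N: graded_group N Ng by fact
  have z: "\<phi> \<zero>\<^bsub>M\<^esub> = \<zero>\<^bsub>N\<^esub>"
    using module_hom_zero[OF M.abelian_group_axioms N.abelian_group_axioms graded_homD(1)[OF \<phi>]] .
  from x show ?thesis
  proof (induction rule: M.homogeneous_induct)
    case zero
    then show ?case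
      using N.parts_homogeneous[OF N.zero_component] M.parts_homogeneous[OF M.zero_component] z
      by simp
  next
    case (add x y)
    then show ?case
      using graded_homD(2)[OF \<phi>] module_hom_add[OF graded_homD(1)[OF \<phi>]]
      by (simp add: M.parts_add N.parts_add)
  next
    case (homogeneous x j)
    then show ?case
      using N.parts_homogeneous[OF graded_homD(3)[OF \<phi>]] M.parts_homogeneous z by simp
  qed
qed

text \<open>Projections and injections replace the isomorphism. The point to prove is that the
  injections are homogeneous of degree \<open>- s\<close>, since the isomorphism is only assumed to
  respect degrees in one direction.\<close>

lemma graded_iso_direct_sum_maps:
  assumes "graded_module R Rg M Mg" "graded_module R Rg A Ag" "graded_module R Rg B Bg"
    and "graded_iso_upto_shift R M Mg (direct_sum A B) (sum_grading Ag Bg)"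
  obtains s p q i j where
    "p \<in> graded_hom R M Mg A Ag s" "q \<in> graded_hom R M Mg B Bg s"
    "i \<in> graded_hom R A Ag M Mg (- s)" "j \<in> graded_hom R B Bg M Mg (- s)"
    "\<And>x. x \<in> carrier M \<Longrightarrow> i (p x) \<oplus>\<^bsub>M\<^esub> j (q x) = x"
    "\<And>y. y \<in> carrier A \<Longrightarrow> p (i y) = y"
proof -
  interpret M: graded_module R Rg M Mg by fact
  interpret A: graded_module R Rg A Ag by fact
  interpret B: graded_module R Rg B Bg by fact
  interpret Mg: graded_group M Mg by (rule M.graded_group_module)
  interpret Ag: graded_group A Ag by (rule A.graded_group_module)
  interpret Bg: graded_group B Bg by (rule B.graded_group_module)
  obtain s \<Phi> where \<Phi>: "\<Phi> \<in> graded_hom R M Mg (direct_sum A B) (sum_grading Ag Bg) s"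
    and bij: "bij_betw \<Phi> (carrier M) (carrier (direct_sum A B))"
    using assms(4) by (auto simp: graded_iso_upto_shift_def)
  define p where "p x = fst (\<Phi> x)" for x
  define q where "q x = snd (\<Phi> x)" for x
  define \<Psi> where "\<Psi> = inv_into (carrier M) \<Phi>"
  have p: "p \<in> graded_hom R M Mg A Ag s" and q: "q \<in> graded_hom R M Mg B Bg s"
    unfolding p_def q_def
    using graded_homD(2,3)[OF \<Phi>] module_hom_add[OF graded_homD(1)[OF \<Phi>]]
      module_hom_smult[OF graded_homD(1)[OF \<Phi>]]
    by (auto intro!: graded_homI simp: direct_sum_def sum_grading_def mem_Times_iff)
  \<comment> \<open>Joint injectivity of \<open>p\<close> and \<open>q\<close>: every identity in
    \<open>M\<close> below is checked on the two coordinates.\<close>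
  have eqI: "x = y" if "x \<in> carrier M" "y \<in> carrier M" "p x = p y" "q x = q y" for x y
    using that bij by (auto simp: bij_betw_def inj_on_def p_def q_def prod_eq_iff)
  have \<Psi>: "\<Psi> (y, z) \<in> carrier M" "p (\<Psi> (y, z)) = y" "q (\<Psi> (y, z)) = z"
    if "y \<in> carrier A" "z \<in> carrier B" for y z
  proof -
    have "(y, z) \<in> \<Phi> ` carrier M"
      using that bij by (auto simp: bij_betw_def direct_sum_def)
    then show "\<Psi> (y, z) \<in> carrier M" "p (\<Psi> (y, z)) = y" "q (\<Psi> (y, z)) = z"
      by (auto simp: \<Psi>_def p_def q_def f_inv_into_f inv_into_into)
  qed
  have p0: "p \<zero>\<^bsub>M\<^esub> = \<zero>\<^bsub>A\<^esub>" and q0: "q \<zero>\<^bsub>M\<^esub> = \<zero>\<^bsub>B\<^esub>"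
    using module_hom_zero[OF M.abelian_group_axioms A.abelian_group_axioms graded_homD(1)[OF p]]
      module_hom_zero[OF M.abelian_group_axioms B.abelian_group_axioms graded_homD(1)[OF q]] .
  \<comment> \<open>Homogeneity is detected by the coordinates: parts of \<open>x\<close> in other
    degrees are killed by both \<open>p\<close> and \<open>q\<close>, hence vanish.\<close>
  have deg: "x \<in> Mg k" if x: "x \<in> carrier M" and px: "p x \<in> Ag (k + s)" and qx: "q x \<in> Bg (k + s)"
    for x k
  proof -
    have "Mg.parts x j = \<zero>\<^bsub>M\<^esub>" if "j \<noteq> k" for j
    proof (rule eqI)
      show "p (Mg.parts x j) = p \<zero>\<^bsub>M\<^esub>"
        using graded_hom_parts[OF Mg.graded_group_axioms Ag.graded_group_axioms p x, of j]
          Ag.parts_homogeneous[OF px] that p0 by simp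
      show "q (Mg.parts x j) = q \<zero>\<^bsub>M\<^esub>"
        using graded_hom_parts[OF Mg.graded_group_axioms Bg.graded_group_axioms q x, of j]
          Bg.parts_homogeneous[OF qx] that q0 by simp
    qed (use x in auto)
    then have "(\<Oplus>\<^bsub>M\<^esub>i\<in>{k}. Mg.parts x i) = x"
      by (intro Mg.sum_parts_superset) (use x in auto)
    then have "Mg.parts x k = x" using x by simp
    then show ?thesis using Mg.parts_component[OF x, of k] by simp
  qed
  note add_p = module_hom_add[OF graded_homD(1)[OF p]] and smult_p = module_hom_smult[OF graded_homD(1)[OF p]]
  note add_q = module_hom_add[OF graded_homD(1)[OF q]] and smult_q = module_hom_smult[OF graded_homD(1)[OF q]]
  let ?i = "\<lambda>y. \<Psi> (y, \<zero>\<^bsub>B\<^esub>)" and ?j = "\<lambda>z. \<Psi> (\<zero>\<^bsub>A\<^esub>, z)"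
  have "?i \<in> graded_hom R A Ag M Mg (- s)"
    by (rule graded_homI)
      (auto intro!: eqI deg simp: \<Psi> Ag.component_carrier add_p add_q smult_p smult_q)
  moreover have "?j \<in> graded_hom R B Bg M Mg (- s)"
    by (rule graded_homI)
      (auto intro!: eqI deg simp: \<Psi> Bg.component_carrier add_p add_q smult_p smult_q)
  moreover have "?i (p x) \<oplus>\<^bsub>M\<^esub> ?j (q x) = x" if "x \<in> carrier M" for x
    by (rule eqI) (use that graded_homD(2)[OF p] graded_homD(2)[OF q] in \<open>auto simp: \<Psi> add_p add_q\<close>)
  moreover have "p (?i y) = y" if "y \<in> carrier A" for y
    using that by (simp add: \<Psi>)
  ultimately show ?thesis using that p q by blast
qed

lemma (in graded_ring) graded_hom_in_star_hom:
  assumes "\<phi> \<in> graded_hom R M Mg (ideal_module R (carrier R)) Rg i"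
  shows "\<phi> \<in> star_hom R M Mg (ideal_module R (carrier R)) Rg"
proof -
  have "\<phi> x = (\<Oplus>\<^bsub>ideal_module R (carrier R)\<^esub>j\<in>{i}. \<phi> x)" if "x \<in> carrier M" for x
    using graded_homD(2)[OF assms that] by (simp add: finsum_ideal_module_carrier)
  then show ?thesis
    using assms graded_homD(1)[OF assms] unfolding star_hom_def
    by (intro CollectI conjI exI[of _ "{i}"] exI[of _ "\<lambda>_. \<phi>"]) auto
qed

lemma (in graded_ring) graded_hom_in_trace:
  assumes "\<phi> \<in> graded_hom R M Mg (ideal_module R (carrier R)) Rg i" "x \<in> carrier M"
  shows "\<phi> x \<in> trace_ideal R Rg M Mg"
proof -
  have "(\<Oplus>\<psi>\<in>{\<phi>}. \<psi> x) = \<phi> x"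
    using graded_homD(2)[OF assms] by simp
  then show ?thesis
    unfolding trace_ideal_def
    by (intro CollectI exI[of _ "{\<phi>}"] exI[of _ "\<lambda>_. x"] conjI)
      (simp_all add: graded_hom_in_star_hom[OF assms(1)] assms(2))
qed

text \<open>Splitting each homomorphism and each argument into homogeneous pieces and taking the
  part of degree \<alpha> writes \<open>t\<close> as a sum of values of homogeneous homomorphisms at
  homogeneous elements, with degrees adding up to \<alpha>.\<close>

lemma (in graded_module) trace_component_induct:
  assumes t: "t \<in> trace_ideal R Rg M Mg" "t \<in> Rg \<alpha>"
    and T0: "\<zero> \<in> T" and Tadd: "\<And>x y. x \<in> T \<Longrightarrow> y \<in> T \<Longrightarrow> x \<oplus> y \<in> T"
    and T: "\<And>\<phi> i x k. \<phi> \<in> graded_hom R M Mg (ideal_module R (carrier R)) Rg i \<Longrightarrow>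
      x \<in> Mg k \<Longrightarrow> k + i = \<alpha> \<Longrightarrow> \<phi> x \<in> T"
  shows "t \<in> T"
proof -
  interpret rg: graded_group R Rg by (rule graded_group_ring)
  interpret mg: graded_group M Mg by (rule graded_group_module)
  interpret RM: module R "ideal_module R (carrier R)"
    by (rule module_ideal_module[OF oneideal])
  note ring_finsum_induct = abelian_monoid.finsum_induct[OF abelian_group.axioms(1)[OF is_abelian_group]]
  \<comment> \<open>The summands of \<open>t\<close> need not be homogeneous, so the property speaks
    of their part of degree \<alpha>; for \<open>t\<close> this part is \<open>t\<close>
    itself.\<close>
  let ?P = "\<lambda>z. rg.parts z \<alpha> \<in> T"
  have P0: "?P \<zero>" using rg.parts_homogeneous[OF rg.zero_component] T0 by simp
  have Padd: "?P (x \<oplus> y)" if "x \<in> carrier R" "y \<in> carrier R" "?P x" "?P y" for x y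
    using that by (simp add: rg.parts_add Tadd)
  have hom: "?P (\<phi> x)"
    if \<phi>: "\<phi> \<in> graded_hom R M Mg (ideal_module R (carrier R)) Rg i" and x: "x \<in> carrier M" for \<phi> i x
    using x
  proof (induction rule: mg.homogeneous_induct)
    case zero
    have "\<phi> \<zero>\<^bsub>M\<^esub> = \<zero>"
      using module_hom_zero[OF M.abelian_group_axioms RM.abelian_group_axioms graded_homD(1)[OF \<phi>]]
      by simp
    then show ?case using P0 by simp
  next
    case (add x y)
    then show ?case
      using Padd graded_homD(2)[OF \<phi>] module_hom_add[OF graded_homD(1)[OF \<phi>]] by simp
  next
    case (homogeneous x k)
    then show ?case
      using rg.parts_homogeneous[OF graded_homD(3)[OF \<phi> homogeneous]] T[OF \<phi> homogeneous] T0 by simp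
  qed
  have star: "?P (\<phi> x)"
    if "\<phi> \<in> star_hom R M Mg (ideal_module R (carrier R)) Rg" and x: "x \<in> carrier M" for \<phi> x
  proof -
    obtain J \<psi> where J: "finite J"
      and \<psi>: "\<And>i. i \<in> J \<Longrightarrow> \<psi> i \<in> graded_hom R M Mg (ideal_module R (carrier R)) Rg i"
      and eq: "\<phi> x = (\<Oplus>i\<in>J. \<psi> i x)"
      using \<open>\<phi> \<in> _\<close> x unfolding star_hom_def finsum_ideal_module_carrier by blast
    have "?P (\<Oplus>i\<in>J. \<psi> i x)"
      by (rule ring_finsum_induct[OF J _ P0 Padd hom[OF \<psi> x]])
        (use graded_homD(2)[OF \<psi> x] in auto)
    then show ?thesis using eq by simp
  qed
  obtain F x where F: "finite F" "F \<subseteq> star_hom R M Mg (ideal_module R (carrier R)) Rg"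
    and x: "\<And>\<phi>. \<phi> \<in> F \<Longrightarrow> x \<phi> \<in> carrier M" and t': "t = (\<Oplus>\<phi>\<in>F. \<phi> (x \<phi>))"
    using t(1) unfolding trace_ideal_def by blast
  have "\<phi> (x \<phi>) \<in> carrier R" if "\<phi> \<in> F" for \<phi>
    using F(2) x[OF that] that by (auto simp: star_hom_def module_hom_def)
  then have "?P t"
    unfolding t'
    by (rule ring_finsum_induct[OF F(1) _ P0 Padd]) (use star x F(2) in auto)
  then show ?thesis using rg.parts_homogeneous[OF t(2)] by simp
qed


subsection \<open>One-dimensional components\<close>

text \<open>A non-zero vector is independent because non-zero coefficients are invertible; being one
  vector in dimension one, it is a basis.\<close>

lemma (in vectorspace) dim_one_multiple:
  assumes "fin_dim" "dim = 1" "v \<in> carrier V" "v \<noteq> \<zero>\<^bsub>V\<^esub>" "w \<in> carrier V"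
  shows "\<exists>c\<in>carrier K. w = c \<odot>\<^bsub>V\<^esub> v"
proof -
  have one: "lincomb c {v} = c v \<odot>\<^bsub>V\<^esub> v" if "c v \<in> carrier K" for c
    using that assms(3) by (simp add: lincomb_def)
  have "lin_indpt {v}"
  proof
    assume "lin_dep {v}"
    then obtain A a u where A: "A \<subseteq> {v}" "a \<in> A \<rightarrow> carrier K" "lincomb a A = \<zero>\<^bsub>V\<^esub>" "u \<in> A" "a u \<noteq> \<zero>\<^bsub>K\<^esub>"
      unfolding lin_dep_def by blast
    then have "A = {v}" "u = v" by auto
    with A have av: "a v \<in> carrier K" "a v \<noteq> \<zero>\<^bsub>K\<^esub>" "a v \<odot>\<^bsub>V\<^esub> v = \<zero>\<^bsub>V\<^esub>"
      using one by auto
    then have "a v \<in> Units K" using field_Units by blast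
    then obtain b where "b \<in> carrier K" "b \<otimes>\<^bsub>K\<^esub> a v = \<one>\<^bsub>K\<^esub>" unfolding Units_def by blast
    then have "v = b \<odot>\<^bsub>V\<^esub> (a v \<odot>\<^bsub>V\<^esub> v)"
      using assms(3) av(1) smult_assoc1[of b "a v" v] by simp
    then show False using av \<open>b \<in> carrier K\<close> assms(4) by simp
  qed
  then have "basis {v}"
    using dim_li_is_basis[of "{v}"] assms by simp
  then have "w \<in> span {v}" using assms(5) by (simp add: basis_def)
  then obtain a A where A: "A \<subseteq> {v}" "a \<in> A \<rightarrow> carrier K" "w = lincomb a A"
    unfolding span_def by blast
  show ?thesis
  proof (cases "A = {}")
    case True
    then have "w = \<zero>\<^bsub>V\<^esub>" using A by (simp add: lincomb_def)
    then show ?thesis using assms(3) by (intro bexI[of _ "\<zero>\<^bsub>K\<^esub>"]) auto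
  next
    case False
    then have "A = {v}" using A by auto
    then show ?thesis using A one by auto
  qed
qed

text \<open>Scalars of degree 0 preserve each component, which gives meaning to its dimension over
  \<open>Rg 0\<close>.\<close>

lemma (in graded_module) component_vectorspace:
  assumes "field (R\<lparr>carrier := Rg 0\<rparr>)"
  shows "vectorspace (R\<lparr>carrier := Rg 0\<rparr>) (M\<lparr>carrier := Mg k\<rparr>)"
proof -
  interpret rg: graded_group R Rg by (rule graded_group_ring)
  interpret mg: graded_group M Mg by (rule graded_group_module)
  have *: "abelian_group (M\<lparr>carrier := Mg k\<rparr>)"
  proof (rule abelian_groupI)
    fix x assume "x \<in> carrier (M\<lparr>carrier := Mg k\<rparr>)"
    then show "\<exists>y\<in>carrier (M\<lparr>carrier := Mg k\<rparr>). y \<oplus>\<^bsub>M\<lparr>carrier := Mg k\<rparr>\<^esub> x = \<zero>\<^bsub>M\<lparr>carrier := Mg k\<rparr>\<^esub>"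
      by (intro bexI[of _ "\<ominus>\<^bsub>M\<^esub> x"]) (auto simp: M.l_neg mg.component_carrier)
  qed (use mg.component_carrier M.a_assoc M.a_comm in auto)
  have "module (R\<lparr>carrier := Rg 0\<rparr>) (M\<lparr>carrier := Mg k\<rparr>)"
    by (rule moduleI[OF fieldE(1)[OF assms] *])
      (use graded_smult[of _ 0 _ k] rg.component_carrier mg.component_carrier in
        \<open>auto simp: smult_l_distr smult_r_distr smult_assoc1\<close>)
  then show ?thesis using assms by (rule vectorspace.intro)
qed


subsection \<open>Regular sequences and homomorphisms on ideals\<close>

lemma (in cring) nonzerodivisor_quotD:
  assumes "ideal J R" "nonzerodivisor (R Quot J) (J +> x)"
    and "x \<in> carrier R" "y \<in> carrier R" "x \<otimes> y \<in> J"
  shows "y \<in> J"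
proof -
  interpret J: ideal J R by fact
  have "(J +> x) \<otimes>\<^bsub>R Quot J\<^esub> (J +> y) = \<zero>\<^bsub>R Quot J\<^esub>"
    using assms J.rcoset_mult_add a_rcos_zero[OF assms(1)] by (simp add: FactRing_def)
  moreover have "J +> y \<in> carrier (R Quot J)"
    using assms a_rcosetsI[OF J.a_subset] by (simp add: FactRing_def)
  ultimately have "J +> y = J"
    using assms(2) unfolding nonzerodivisor_def by (simp add: FactRing_def)
  then show ?thesis using J.rcos_const_imp_mem assms(4) by blast
qed

text \<open>The definition unfolded on elements: index 0 is the quotient by the zero ideal, index 1
  the quotient by the principal ideal of \<open>x\<close>.\<close>

lemma (in cring) regular_sequence_pairD:
  assumes "regular_sequence R [x, y]"
  shows "x \<in> carrier R" "y \<in> carrier R" "nonzerodivisor R x"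
    and "\<And>z. z \<in> carrier R \<Longrightarrow> y \<otimes> z \<in> PIdl x \<Longrightarrow> z \<in> PIdl x"
proof -
  show x: "x \<in> carrier R" and y: "y \<in> carrier R"
    using assms by (auto simp: regular_sequence_def)
  have 1: "nonzerodivisor (R Quot (Idl {})) (Idl {} +> x)"
    and 2: "nonzerodivisor (R Quot (Idl {x})) (Idl {x} +> y)"
    using assms[unfolded regular_sequence_def Let_def, THEN conjunct2, THEN conjunct1, rule_format, of 0]
      assms[unfolded regular_sequence_def Let_def, THEN conjunct2, THEN conjunct1, rule_format, of 1]
    by simp_all
  have 0: "Idl {} = {\<zero>}"
  proof
    show "Idl {} \<subseteq> {\<zero>}" by (rule genideal_minimal[OF zeroideal]) simp
    show "{\<zero>} \<subseteq> Idl {}"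
      using additive_subgroup.zero_closed[OF ideal.axioms(1)[OF genideal_ideal[of "{}"]]] by simp
  qed
  show "nonzerodivisor R x"
    unfolding nonzerodivisor_def
    using nonzerodivisor_quotD[OF zeroideal 1[unfolded 0] x] x by auto
  show "z \<in> PIdl x" if "z \<in> carrier R" "y \<otimes> z \<in> PIdl x" for z
    using nonzerodivisor_quotD[OF cgenideal_ideal[OF x] _ y that] 2 cgenideal_eq_genideal[OF x] by simp
qed

lemma (in cring) nonzerodivisor_cancel:
  assumes "nonzerodivisor R f" "x \<in> carrier R" "y \<in> carrier R" "f \<otimes> x = f \<otimes> y"
  shows "x = y"
proof -
  have f: "f \<in> carrier R" using assms(1) by (simp add: nonzerodivisor_def)
  then have "f \<otimes> (x \<ominus> y) = \<zero>"
    using assms(2-4) by (simp add: minus_eq r_distr r_minus r_neg)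
  then have "x \<ominus> y = \<zero>"
    using assms(1-3) unfolding nonzerodivisor_def by simp
  then show ?thesis using assms(2,3) by simp
qed

text \<open>Both sides equal \<phi> at the product of \<open>x\<close> and \<open>y\<close>. This
  expresses that \<phi> is multiplication by a fraction without forming a ring of fractions.\<close>

lemma (in cring) ideal_hom_swap:
  assumes "ideal I R" "\<phi> \<in> module_hom R (ideal_module R I) (ideal_module R (carrier R))"
    and "x \<in> I" "y \<in> I"
  shows "x \<otimes> \<phi> y = y \<otimes> \<phi> x"
proof -
  have xy: "x \<in> carrier R" "y \<in> carrier R" using assms ideal.Icarr by fast+
  have "x \<otimes> \<phi> y = \<phi> (x \<otimes> y)"
    using module_hom_smult[OF assms(2), of x y] xy assms(4) by simp
  also have "\<dots> = y \<otimes> \<phi> x"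
    using module_hom_smult[OF assms(2), of y x] xy assms(3) by (simp add: m_comm)
  finally show ?thesis .
qed

text \<open>Homomorphisms out of \<open>I\<close> are multiplications by fractions with denominator \<open>f\<close>; so
  \<open>\<theta>\<^sub>1/f\<close> and \<open>\<theta>\<^sub>2/f\<close> both map \<open>I\<close> into \<open>R\<close>, and regularity forces \<open>I \<subseteq> Rf\<close>.\<close>

lemma (in cring) principal_of_regular_values:
  assumes I: "ideal I R" and fI: "f \<in> I" and f: "nonzerodivisor R f"
    and \<phi>: "\<phi> \<in> module_hom R (ideal_module R I) (ideal_module R (carrier R))"
    and \<psi>: "\<psi> \<in> module_hom R (ideal_module R I) (ideal_module R (carrier R))"
    and reg: "regular_sequence R [\<phi> f, \<psi> f]"
  shows "PIdl f = I"
proof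
  note r = regular_sequence_pairD[OF reg]
  have fR: "f \<in> carrier R" using f by (simp add: nonzerodivisor_def)
  show "PIdl f \<subseteq> I" by (rule cgenideal_minimal[OF I fI])
  show "I \<subseteq> PIdl f"
  proof
    fix x assume x: "x \<in> I"
    have xR: "x \<in> carrier R" using x I ideal.Icarr by fast
    have \<phi>x: "\<phi> x \<in> carrier R" and \<psi>x: "\<psi> x \<in> carrier R"
      using module_hom_closed[OF \<phi>] module_hom_closed[OF \<psi>] x by auto
    have 1: "f \<otimes> \<phi> x = x \<otimes> \<phi> f" and 2: "f \<otimes> \<psi> x = x \<otimes> \<psi> f"
      using ideal_hom_swap[OF I \<phi> fI x] ideal_hom_swap[OF I \<psi> fI x] .
    \<comment> \<open>The products of \<open>\<psi> f\<close> with \<open>\<phi> x\<close> and of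
      \<open>\<psi> x\<close> with \<open>\<phi> f\<close> agree after multiplication by
      \<open>f\<close>: each becomes the product of \<open>x\<close>, \<open>\<phi> f\<close> and
      \<open>\<psi> f\<close>. Then \<open>f\<close> cancels.\<close>
    have "f \<otimes> (\<psi> f \<otimes> \<phi> x) = \<psi> f \<otimes> (x \<otimes> \<phi> f)"
      using m_lcomm[OF fR r(2) \<phi>x] 1 by simp
    also have "\<dots> = \<phi> f \<otimes> (x \<otimes> \<psi> f)"
      using xR r(1,2) by (simp add: m_ac)
    also have "\<dots> = f \<otimes> (\<psi> x \<otimes> \<phi> f)"
      unfolding 2[symmetric] using fR \<psi>x r(1) by (simp add: m_ac)
    finally have "\<psi> f \<otimes> \<phi> x = \<psi> x \<otimes> \<phi> f"
      using nonzerodivisor_cancel[OF f] \<phi>x \<psi>x r(1,2) by simp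
    then have "\<psi> f \<otimes> \<phi> x \<in> PIdl (\<phi> f)"
      using \<psi>x by (auto simp: cgenideal_def)
    \<comment> \<open>Here \<open>\<psi> f\<close> is cancelled modulo \<open>\<phi> f\<close>;
      afterwards \<open>\<phi> f\<close> itself is cancelled.\<close>
    then have "\<phi> x \<in> PIdl (\<phi> f)" using r(4) \<phi>x by blast
    then obtain y where y: "y \<in> carrier R" "\<phi> x = y \<otimes> \<phi> f"
      by (auto simp: cgenideal_def)
    have "\<phi> f \<otimes> x = \<phi> f \<otimes> (y \<otimes> f)"
      using 1 y r(1) fR xR by (simp add: m_ac)
    then have "x = y \<otimes> f"
      using nonzerodivisor_cancel[OF r(3)] y fR xR by simp
    then show "x \<in> PIdl f" using y by (auto simp: cgenideal_def)
  qed
qed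


subsection \<open>Detecting the free summand\<close>

text \<open>For positive \<open>i\<close> the component \<open>Rg i\<close> lies in the irrelevant
  ideal. Degree 0 is left out because \<open>Rg 0\<close> does not.\<close>

lemma (in positively_graded_ring) zero_below_indeg_irrelevant:
  assumes "indeg (ideal_module R (irrelevant_ideal R Rg))
      (ideal_grading Rg (irrelevant_ideal R Rg)) = Fin \<alpha>" "i < \<alpha>" "i \<noteq> 0"
  shows "Rg i = {\<zero>}"
proof (cases "i < 0")
  case False
  interpret rg: graded_group R Rg by (rule graded_group_ring)
  have "Rg i \<subseteq> irrelevant_ideal R Rg"
  proof
    fix x assume x: "x \<in> Rg i"
    then have "x = (\<Oplus>j\<in>{i}. x)" using rg.component_carrier[OF x] by simp
    then show "x \<in> irrelevant_ideal R Rg"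
      unfolding irrelevant_ideal_def
      by (intro CollectI exI[of _ "{i}"] exI[of _ "\<lambda>_. x"]) (use x False assms(3) in auto)
  qed
  then show ?thesis
    using indeg_below[OF assms(1,2)] by (auto simp: ideal_grading_def)
qed (rule negative_parts)

text \<open>The value at \<open>f\<close> is a non-zero element of the field \<open>Rg 0\<close>,
  hence has an inverse \<open>u\<close>, and any \<open>r\<close> is the image of the product of
  \<open>r\<close>, \<open>u\<close> and \<open>f\<close>.\<close>

lemma (in graded_ring) has_free_summandI:
  assumes "field (R\<lparr>carrier := Rg 0\<rparr>)" and I: "ideal I R"
    and \<phi>: "\<phi> \<in> graded_hom R (ideal_module R I) Ig (ideal_module R (carrier R)) Rg (- d)"
    and f: "f \<in> I" "f \<in> Ig d" and nz: "\<phi> f \<noteq> \<zero>"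
  shows "has_free_summand R Rg (ideal_module R I) Ig (- d)"
proof -
  interpret K: field "R\<lparr>carrier := Rg 0\<rparr>" by fact
  interpret rg: graded_group R Rg by (rule graded_group_ring)
  have "\<phi> f \<in> Rg 0" using graded_homD(3)[OF \<phi> f(2)] by simp
  then have "\<phi> f \<in> Units (R\<lparr>carrier := Rg 0\<rparr>)" using nz K.field_Units by simp
  then obtain u where u: "u \<in> carrier R" "u \<otimes> \<phi> f = \<one>"
    using rg.component_carrier unfolding Units_def by auto
  have \<phi>R: "\<phi> x \<in> carrier R" if "x \<in> I" for x
    using graded_homD(2)[OF \<phi>] that by simp
  have "r \<in> \<phi> ` I" if r: "r \<in> carrier R" for r
  proof
    show "r \<otimes> u \<otimes> f \<in> I" using I f(1) r u(1) by (simp add: ideal.I_l_closed)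
    have "\<phi> (r \<otimes> u \<otimes> f) = r \<otimes> u \<otimes> \<phi> f"
      using module_hom_smult[OF graded_homD(1)[OF \<phi>], of "r \<otimes> u" f] r u(1) f(1) by simp
    then show "r = \<phi> (r \<otimes> u \<otimes> f)"
      using r u \<phi>R[OF f(1)] by (simp add: m_assoc)
  qed
  then have "\<phi> ` I = carrier R" using \<phi>R by blast
  then show ?thesis unfolding has_free_summand_def using \<phi> by auto
qed

theorem theorem3p4:
  fixes R :: "('a, 'r) ring_scheme" and Rg :: "int \<Rightarrow> 'a set"
    and I :: "'a set" and f \<theta>\<^sub>1 \<theta>\<^sub>2 :: 'a
    and M :: "('a, 'b, 'm) module_scheme" and Mg :: "int \<Rightarrow> 'b set"
    and N :: "('a, 'c, 'n) module_scheme" and Ng :: "int \<Rightarrow> 'c set"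
  defines "K \<equiv> R\<lparr>carrier := Rg 0\<rparr>"
    and "I\<^sub>M \<equiv> ideal_module R I" and "Ig \<equiv> ideal_grading Rg I"
    and "\<mm> \<equiv> irrelevant_ideal R Rg"
  defines "a \<equiv> indeg (ideal_module R \<mm>) (ideal_grading Rg \<mm>)"
    and "trN \<equiv> trace_ideal R Rg N Ng"
    and "V \<equiv> M\<lparr>carrier := component M Mg (indeg M Mg)\<rparr>"
  assumes "positively_graded_ring R Rg" and "field K"
    and "graded_ideal R Rg I"
    and "f \<in> component I\<^sub>M Ig (indeg I\<^sub>M Ig)" and "nonzerodivisor R f"
    and "PIdl\<^bsub>R\<^esub> f \<noteq> I"
    and "graded_module R Rg M Mg" and "indeg M Mg < Pinf"
    and "graded_module R Rg N Ng"
    and "graded_iso_upto_shift R M Mg (direct_sum I\<^sub>M N) (sum_grading Ig Ng)"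
    and "indeg I\<^sub>M Ig < indeg N Ng"
    and "component (ideal_module R trN) (ideal_grading Rg trN) a = {\<zero>\<^bsub>R\<^esub>}"
    and "regular_sequence R [\<theta>\<^sub>1, \<theta>\<^sub>2]"
    and "\<theta>\<^sub>1 \<in> component R Rg a" and "\<theta>\<^sub>2 \<in> component R Rg a"
    and "\<theta>\<^sub>1 \<in> trace_ideal R Rg M Mg" and "\<theta>\<^sub>2 \<in> trace_ideal R Rg M Mg"
    and "vectorspace.fin_dim K V" and "vectorspace.dim K V = 1"
  shows "\<exists>d. indeg I\<^sub>M Ig = Fin d \<and> has_free_summand R Rg I\<^sub>M Ig (- d)"
proof -
  interpret R: positively_graded_ring R Rg by fact
  interpret M: graded_module R Rg M Mg by fact
  interpret N: graded_module R Rg N Ng by fact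
  have IM: "graded_module R Rg I\<^sub>M Ig"
    unfolding I\<^sub>M_def Ig_def by (rule R.graded_module_ideal) fact
  have I: "ideal I R" using \<open>graded_ideal R Rg I\<close> by (simp add: graded_ideal_def)
  interpret I: ideal I R by fact
  interpret rg: graded_group R Rg by (rule R.graded_group_ring)
  interpret mg: graded_group M Mg by (rule M.graded_group_module)
  interpret ng: graded_group N Ng by (rule N.graded_group_module)
  interpret ig: graded_group I\<^sub>M Ig by (rule graded_module.graded_group_module[OF IM])
  let ?R = "ideal_module R (carrier R)"
  interpret RM: module R ?R by (rule R.module_ideal_module[OF R.oneideal])
  have IM_simps [simp]: "carrier I\<^sub>M = I" "\<zero>\<^bsub>I\<^sub>M\<^esub> = \<zero>\<^bsub>R\<^esub>" by (simp_all add: I\<^sub>M_def)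
  note reg = \<open>regular_sequence R [\<theta>\<^sub>1, \<theta>\<^sub>2]\<close>
  note r = R.regular_sequence_pairD[OF reg]
  note nzf = \<open>nonzerodivisor R f\<close>
  \<comment> \<open>In the trivial ring zero would be a \<open>nonzerodivisor\<close>; the field in
    degree 0 excludes this.\<close>
  have "\<one>\<^bsub>R\<^esub> \<noteq> \<zero>\<^bsub>R\<^esub>" using fieldE(2)[OF \<open>field K\<close>] by (simp add: K_def)
  then have nz: "x \<noteq> \<zero>\<^bsub>R\<^esub>" if "nonzerodivisor R x" for x
    using that R.l_null[OF R.one_closed] unfolding nonzerodivisor_def by blast
  \<comment> \<open>At an infinite degree \<open>component\<close> is zero by convention, so the
    non-zero \<open>f\<close> makes the degree finite. The same argument with
    \<open>\<theta>\<^sub>1\<close> yields \<alpha>.\<close>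
  obtain d where d: "indeg I\<^sub>M Ig = Fin d" and fd: "f \<in> Ig d"
    using \<open>f \<in> component _ _ _\<close> nz[OF nzf] by (cases "indeg I\<^sub>M Ig") (auto simp: component_def)
  have fI: "f \<in> I" using ig.component_carrier[OF fd] by simp
  obtain \<alpha> where \<alpha>: "a = Fin \<alpha>"
    using \<open>\<theta>\<^sub>1 \<in> component R Rg a\<close> nz[OF r(3)] by (cases a) (auto simp: component_def)
  have \<theta>: "\<theta>\<^sub>1 \<in> Rg \<alpha>" "\<theta>\<^sub>2 \<in> Rg \<alpha>"
    using \<open>\<theta>\<^sub>1 \<in> component R Rg a\<close> \<open>\<theta>\<^sub>2 \<in> component R Rg a\<close> \<alpha> by (auto simp: component_def)
  have Rg0: "Rg i = {\<zero>\<^bsub>R\<^esub>}" if "i < \<alpha>" "i \<noteq> 0" for i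
    using R.zero_below_indeg_irrelevant[OF _ that] \<alpha> by (simp add: a_def \<mm>_def)
  have trN0: "t = \<zero>\<^bsub>R\<^esub>" if "t \<in> trace_ideal R Rg N Ng" "t \<in> Rg \<alpha>" for t
    using \<open>component (ideal_module R trN) _ a = _\<close> that \<alpha>
    by (auto simp: component_def ideal_grading_def trN_def)
  have Ig0: "Ig i = {\<zero>\<^bsub>R\<^esub>}" if "i < d" for i
    using indeg_below[OF d that] by simp
  have Ng0: "Ng i = {\<zero>\<^bsub>N\<^esub>}" if "i \<le> d" for i
    by (rule ng.indeg_greater[OF _ that]) (use \<open>indeg I\<^sub>M Ig < indeg N Ng\<close> d in simp)
  obtain s p q \<iota> \<kappa> where p: "p \<in> graded_hom R M Mg I\<^sub>M Ig s" and q: "q \<in> graded_hom R M Mg N Ng s"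
    and \<iota>: "\<iota> \<in> graded_hom R I\<^sub>M Ig M Mg (- s)" and \<kappa>: "\<kappa> \<in> graded_hom R N Ng M Mg (- s)"
    and split: "\<And>x. x \<in> carrier M \<Longrightarrow> \<iota> (p x) \<oplus>\<^bsub>M\<^esub> \<kappa> (q x) = x"
    and p\<iota>: "\<And>y. y \<in> I \<Longrightarrow> p (\<iota> y) = y"
    using graded_iso_direct_sum_maps[OF M.graded_module_axioms IM N.graded_module_axioms
        \<open>graded_iso_upto_shift R M Mg _ _\<close>] by (metis IM_simps(1))
  have \<iota>0: "\<iota> \<zero>\<^bsub>R\<^esub> = \<zero>\<^bsub>M\<^esub>" and p0: "p \<zero>\<^bsub>M\<^esub> = \<zero>\<^bsub>R\<^esub>" and \<kappa>0: "\<kappa> \<zero>\<^bsub>N\<^esub> = \<zero>\<^bsub>M\<^esub>"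
    using module_hom_zero[OF ig.abelian_group_axioms M.abelian_group_axioms graded_homD(1)[OF \<iota>]]
      module_hom_zero[OF M.abelian_group_axioms ig.abelian_group_axioms graded_homD(1)[OF p]]
      module_hom_zero[OF N.abelian_group_axioms M.abelian_group_axioms graded_homD(1)[OF \<kappa>]]
    by simp_all
  have \<iota>f: "\<iota> f \<in> Mg (d - s)" "\<iota> f \<noteq> \<zero>\<^bsub>M\<^esub>"
    using graded_homD(3)[OF \<iota> fd] p\<iota>[OF fI] p0 nz[OF nzf] by auto
  \<comment> \<open>Below degree \<open>d - s\<close> both coordinates vanish, while the image of
    \<open>f\<close> is non-zero in that degree. This identifies the component of dimension
    one.\<close>
  have "indeg M Mg = Fin (d - s)"
  proof (rule mg.indeg_eqI)
    fix i assume i: "i < d - s"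
    have "x = \<zero>\<^bsub>M\<^esub>" if x: "x \<in> Mg i" for x
    proof -
      have "p x = \<zero>\<^bsub>R\<^esub>" "q x = \<zero>\<^bsub>N\<^esub>"
        using graded_homD(3)[OF p x] graded_homD(3)[OF q x] Ig0[of "i + s"] Ng0[of "i + s"] i by auto
      then show ?thesis using split[OF mg.component_carrier[OF x]] \<iota>0 \<kappa>0 by simp
    qed
    then show "Mg i = {\<zero>\<^bsub>M\<^esub>}" using mg.zero_component by blast
  qed (use \<iota>f in blast)
  then have V: "V = M\<lparr>carrier := Mg (d - s)\<rparr>" by (simp add: V_def component_def)
  interpret V: vectorspace K V
    unfolding V K_def by (rule M.component_vectorspace) (use \<open>field K\<close> in \<open>simp add: K_def\<close>)
  \<comment> \<open>The injection \<iota> carries \<open>Ig d\<close> into the one-dimensional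
    component of \<open>M\<close>, which is spanned by the image of \<open>f\<close>; applying
    \<open>p\<close> returns the relation to \<open>I\<close>.\<close>
  have Id: "\<exists>c\<in>carrier R. y = c \<otimes>\<^bsub>R\<^esub> f" if y: "y \<in> Ig d" for y
  proof -
    have yI: "y \<in> I" using ig.component_carrier[OF y] by simp
    obtain c where c: "c \<in> Rg 0" "\<iota> y = c \<odot>\<^bsub>M\<^esub> \<iota> f"
      using V.dim_one_multiple[OF \<open>V.fin_dim\<close> \<open>V.dim = 1\<close>, of "\<iota> f" "\<iota> y"] \<iota>f
        graded_homD(3)[OF \<iota> y] by (auto simp: V K_def)
    have cR: "c \<in> carrier R" using c(1) by blast
    then have "\<iota> y = \<iota> (c \<otimes>\<^bsub>R\<^esub> f)"
      using module_hom_smult[OF graded_homD(1)[OF \<iota>], of c f] c fI by (simp add: I\<^sub>M_def)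
    then have "y = c \<otimes>\<^bsub>R\<^esub> f" using p\<iota> yI I.I_l_closed[OF fI cR] by metis
    then show ?thesis using cR by blast
  qed
  show ?thesis
  proof (intro exI conjI, rule d, rule ccontr)
    assume no_free: "\<not> has_free_summand R Rg I\<^sub>M Ig (- d)"
    have deg0: "\<psi> f = \<zero>\<^bsub>R\<^esub>" if "\<psi> \<in> graded_hom R I\<^sub>M Ig ?R Rg (- d)" for \<psi>
      using R.has_free_summandI[of I \<psi> Ig d f] no_free that fI fd I \<open>field K\<close>
      unfolding K_def I\<^sub>M_def by blast
    define T where "T = {\<psi> f | \<psi>. \<psi> \<in> module_hom R I\<^sub>M ?R}"
    have T0: "\<zero>\<^bsub>R\<^esub> \<in> T"
      unfolding T_def by (intro CollectI exI[of _ "\<lambda>_. \<zero>\<^bsub>R\<^esub>"]) (simp add: module_hom_def)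
    have Tadd: "x \<oplus>\<^bsub>R\<^esub> y \<in> T" if xy: "x \<in> T" "y \<in> T" for x y
    proof -
      obtain \<phi> \<psi> where h: "\<phi> \<in> module_hom R I\<^sub>M ?R" "\<psi> \<in> module_hom R I\<^sub>M ?R"
        and "x = \<phi> f" "y = \<psi> f" using xy by (auto simp: T_def)
      moreover have "(\<lambda>z. \<phi> z \<oplus>\<^bsub>R\<^esub> \<psi> z) \<in> module_hom R I\<^sub>M ?R"
        using h by (auto simp: module_hom_def I\<^sub>M_def Pi_def R.r_distr R.a_ac)
      ultimately show ?thesis unfolding T_def by auto
    qed
    have Tsmult: "c \<otimes>\<^bsub>R\<^esub> \<psi> f \<in> T" if c: "c \<in> carrier R" and h: "\<psi> \<in> module_hom R I\<^sub>M ?R" for c \<psi>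
    proof -
      have "(\<lambda>z. c \<otimes>\<^bsub>R\<^esub> \<psi> z) \<in> module_hom R I\<^sub>M ?R"
        using h c by (auto simp: module_hom_def I\<^sub>M_def Pi_def R.r_distr R.m_lcomm)
      then show ?thesis unfolding T_def by auto
    qed
    have main: "\<phi> x \<in> T"
      if \<phi>: "\<phi> \<in> graded_hom R M Mg ?R Rg i" and x: "x \<in> Mg k" and ki: "k + i = \<alpha>" for \<phi> i x k
    proof -
      have xM: "x \<in> carrier M" using x by blast
      have \<phi>\<iota>: "\<phi> \<circ> \<iota> \<in> graded_hom R I\<^sub>M Ig ?R Rg (- s + i)"
        and \<phi>\<kappa>: "\<phi> \<circ> \<kappa> \<in> graded_hom R N Ng ?R Rg (- s + i)"
        using graded_hom_comp \<iota> \<kappa> \<phi> by blast+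
      define \<psi> where "\<psi> = \<phi> \<circ> \<iota>"
      define y where "y = p x"
      have \<psi>: "\<psi> \<in> graded_hom R I\<^sub>M Ig ?R Rg (- s + i)" using \<phi>\<iota> by (simp add: \<psi>_def)
      have \<psi>R: "\<psi> z \<in> carrier R" if "z \<in> I" for z using graded_homD(2)[OF \<psi>] that by simp
      have y: "y \<in> Ig (k + s)" using graded_homD(3)[OF p x] by (simp add: y_def)
      have yI: "y \<in> I" using ig.component_carrier[OF y] by simp
      have qx: "q x \<in> Ng (k + s)" using graded_homD(3)[OF q x] .
      \<comment> \<open>The contribution of \<open>N\<close> lies in its trace in degree \<alpha>,
        hence is zero, and only the summand \<open>I\<close> matters.\<close>
      have "\<phi> (\<kappa> (q x)) \<in> Rg \<alpha>"
        using graded_homD(3)[OF \<phi>\<kappa> qx] ki by simp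
      moreover have "\<phi> (\<kappa> (q x)) \<in> trace_ideal R Rg N Ng"
        using R.graded_hom_in_trace[OF \<phi>\<kappa>, of "q x"] qx by auto
      ultimately have "\<phi> (\<kappa> (q x)) = \<zero>\<^bsub>R\<^esub>" using trN0 by blast
      moreover have "\<phi> x = \<phi> (\<iota> (p x)) \<oplus>\<^bsub>R\<^esub> \<phi> (\<kappa> (q x))"
        using module_hom_add[OF graded_homD(1)[OF \<phi>], of "\<iota> (p x)" "\<kappa> (q x)"] split[OF xM]
          graded_homD(2)[OF \<iota>, of "p x"] graded_homD(2)[OF \<kappa>, of "q x"] graded_homD(2)[OF p xM]
          graded_homD(2)[OF q xM] by simp
      ultimately have \<phi>x: "\<phi> x = \<psi> y"
        using \<psi>R[OF yI] by (simp add: \<psi>_def y_def)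
      show ?thesis
      \<comment> \<open>Since \<open>f\<close> is a non-zero divisor, \<psi> vanishes on
        \<open>I\<close> as soon as it vanishes at \<open>f\<close>.\<close>
      proof (cases "\<psi> f = \<zero>\<^bsub>R\<^esub>")
        case True
        then have "f \<otimes>\<^bsub>R\<^esub> \<psi> y = \<zero>\<^bsub>R\<^esub>"
          using R.ideal_hom_swap[OF I, of \<psi> f y] graded_homD(1)[OF \<psi>] fI yI I.Icarr[OF yI]
          by (simp add: I\<^sub>M_def)
        then have "\<psi> y = \<zero>\<^bsub>R\<^esub>" using nzf \<psi>R[OF yI] by (simp add: nonzerodivisor_def)
        then show ?thesis using \<phi>x T0 by simp
      next
        case False
        have "\<psi> f \<in> Rg (d + (- s + i))" using graded_homD(3)[OF \<psi> fd] .
        moreover have "d + (- s + i) \<noteq> 0"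
        proof
          assume "d + (- s + i) = 0"
          then have "- s + i = - d" by simp
          then show False using deg0[of \<psi>] \<psi> False by simp
        qed
        \<comment> \<open>The non-zero value \<open>\<psi> f\<close> has non-zero degree
          \<open>d - s + i\<close>, which is therefore at least \<alpha>. As \<alpha> equals
          \<open>k + i\<close>, the element \<open>y\<close> has degree at most \<open>d\<close>, so
          it is a multiple of \<open>f\<close>.\<close>
        ultimately have "\<alpha> \<le> d + (- s + i)" using Rg0[of "d + (- s + i)"] False by force
        then have ks: "k + s \<le> d" using ki by simp
        obtain c where "c \<in> carrier R" "y = c \<otimes>\<^bsub>R\<^esub> f"
        proof (cases "k + s = d")
          case True
          then show ?thesis using Id y that by blast
        next
          case False
          then have "y = \<zero>\<^bsub>R\<^esub>" using Ig0[of "k + s"] ks y by auto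
          then show ?thesis using that[of "\<zero>\<^bsub>R\<^esub>"] I.Icarr[OF fI] by simp
        qed
        then show ?thesis
          using \<phi>x Tsmult graded_homD(1)[OF \<psi>] module_hom_smult[OF graded_homD(1)[OF \<psi>], of c f] fI
          by (simp add: I\<^sub>M_def)
      qed
    qed
    have "t \<in> T" if "t \<in> trace_ideal R Rg M Mg" "t \<in> Rg \<alpha>" for t
      by (rule M.trace_component_induct[OF that T0]) (use Tadd main in blast)+
    then have "\<theta>\<^sub>1 \<in> T" "\<theta>\<^sub>2 \<in> T"
      using \<theta> \<open>\<theta>\<^sub>1 \<in> trace_ideal R Rg M Mg\<close> \<open>\<theta>\<^sub>2 \<in> trace_ideal R Rg M Mg\<close> by auto
    then obtain \<phi> \<psi> where "\<phi> \<in> module_hom R I\<^sub>M ?R" "\<psi> \<in> module_hom R I\<^sub>M ?R"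
      and "\<theta>\<^sub>1 = \<phi> f" "\<theta>\<^sub>2 = \<psi> f"
      by (auto simp: T_def)
    then have "PIdl\<^bsub>R\<^esub> f = I"
      using R.principal_of_regular_values[OF I fI nzf] reg unfolding I\<^sub>M_def by blast
    then show False using \<open>PIdl\<^bsub>R\<^esub> f \<noteq> I\<close> by contradiction
  qed
qed

end
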